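(* Let $R=\mathbb F_{q_1}\times\cdots\times\mathbb F_{q_t}$ be a product of $t\ge 3$ finite fields of orders $q_1,\dots,q_t$, and let $k^\ast=\operatorname{argmin}_i q_i$ (any index at which $q_i$ is minimal). Then $$\beta(\mathcal D(R))=|Z(R)^*|-\max\Bigl(t,\ 1+\prod_{i\ne k^\ast}(q_i-1)\Bigr).$$
   Context: The product over $i\ne k^\ast$ runs over $i\in\{1,\dots,t\}\setminus\{k^\ast\}$. $Z(R)$ is the set of zero-divisors of $R$ and $Z(R)^*=Z(R)\setminus\{0\}$. $\Gamma(R)$ is the simple graph with vertex set $Z(R)^*$, with distinct $x,y$ adjacent iff $xy=0$. $W\Gamma(R)$ is the simple graph with vertex set $Z(R)^*$, with distinct $x,y$ adjacent iff there exist nonzero $r\in\operatorname{Ann}(x)$ and nonzero $s\in\operatorname{Ann}(y)$ with $rs=0$. The weak zero-divisor difference graph $\mathcal D(R)$ is the graph on $Z(R)^*$ with edge set $E(W\Gamma(R))\setminus E(\Gamma(R))$, with resulting isolated vertices deleted (for $t\ge3$ no vertex is in fact isolated, so the vertex set is $Z(R)^*$). $\beta(G)$ is the vertex cover number, the minimum size of a set of vertices containing an endpoint of every edge of $G$. *)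

theory Defs
  imports "HOL-Algebra.Algebra"
begin

record 'v simple_graph =
  verts :: "'v set"
  edges :: "'v set set"

definition graph_of_adj :: "'v set \<Rightarrow> ('v \<Rightarrow> 'v \<Rightarrow> bool) \<Rightarrow> 'v simple_graph" where
  "graph_of_adj V adj =
     \<lparr>verts = V, edges = {{x, y} | x y. x \<in> V \<and> y \<in> V \<and> x \<noteq> y \<and> adj x y}\<rparr>"

definition vertex_cover :: "'v simple_graph \<Rightarrow> 'v set \<Rightarrow> bool" where
  "vertex_cover G C \<longleftrightarrow> C \<subseteq> verts G \<and> (\<forall>e \<in> edges G. e \<inter> C \<noteq> {})"

text \<open>Finiteness of the cover is required because \<^const>\<open>card\<close> is 0 on infinite sets.\<close>

definition vertex_cover_number :: "'v simple_graph \<Rightarrow> nat" where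
  "vertex_cover_number G = (LEAST n. \<exists>C. finite C \<and> vertex_cover G C \<and> card C = n)"

text \<open>The rings considered are commutative, so left and right notions agree. The element 0
  counts as a zero-divisor (of a nontrivial ring).\<close>

definition zero_divisors :: "('a, 'm) ring_scheme \<Rightarrow> 'a set" where
  "zero_divisors R =
     {x \<in> carrier R. \<exists>y \<in> carrier R - {\<zero>\<^bsub>R\<^esub>}. x \<otimes>\<^bsub>R\<^esub> y = \<zero>\<^bsub>R\<^esub>}"

definition nonzero_zero_divisors :: "('a, 'm) ring_scheme \<Rightarrow> 'a set" where
  "nonzero_zero_divisors R = zero_divisors R - {\<zero>\<^bsub>R\<^esub>}"

definition Ann :: "('a, 'm) ring_scheme \<Rightarrow> 'a \<Rightarrow> 'a set" where
  "Ann R x = {r \<in> carrier R. r \<otimes>\<^bsub>R\<^esub> x = \<zero>\<^bsub>R\<^esub>}"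

definition zero_divisor_graph :: "('a, 'm) ring_scheme \<Rightarrow> 'a simple_graph" where
  "zero_divisor_graph R =
     graph_of_adj (nonzero_zero_divisors R) (\<lambda>x y. x \<otimes>\<^bsub>R\<^esub> y = \<zero>\<^bsub>R\<^esub>)"

definition weak_zero_divisor_graph :: "('a, 'm) ring_scheme \<Rightarrow> 'a simple_graph" where
  "weak_zero_divisor_graph R =
     graph_of_adj (nonzero_zero_divisors R)
       (\<lambda>x y. \<exists>r \<in> Ann R x - {\<zero>\<^bsub>R\<^esub>}. \<exists>s \<in> Ann R y - {\<zero>\<^bsub>R\<^esub>}. r \<otimes>\<^bsub>R\<^esub> s = \<zero>\<^bsub>R\<^esub>)"

definition delete_isolated :: "'v simple_graph \<Rightarrow> 'v simple_graph" where
  "delete_isolated G = \<lparr>verts = {v \<in> verts G. \<exists>e \<in> edges G. v \<in> e}, edges = edges G\<rparr>"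

definition weak_zero_divisor_difference_graph :: "('a, 'm) ring_scheme \<Rightarrow> 'a simple_graph" where
  "weak_zero_divisor_difference_graph R =
     delete_isolated
       \<lparr>verts = nonzero_zero_divisors R,
        edges = edges (weak_zero_divisor_graph R) - edges (zero_divisor_graph R)\<rparr>"

end

theory Submission
  imports Defs
begin

text \<open>Adjacency in the difference graph depends only on supports: distinct \<open>x\<close>, \<open>y\<close> are adjacent
  iff their supports meet and are not both equal to the same coatom (the complement of a single
  index). So an independent set without an element of coatom support has pairwise
  disjoint nonempty supports, hence at most \<open>t\<close> elements; if it contains an element whose support
  is the complement of \<open>i\<close>, then every other element has the same support or has support
  \<open>{i}\<close>, and the latter can happen at most once. Vertex covers are the complements of independent
  sets.\<close>

section \<open>Vertex covers and independent sets\<close>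

definition independent_set :: "'v simple_graph \<Rightarrow> 'v set \<Rightarrow> bool" where
  "independent_set G I \<longleftrightarrow> I \<subseteq> verts G \<and> (\<forall>e \<in> edges G. \<not> e \<subseteq> I)"

lemma vertex_cover_iff_independent_set:
  assumes "edges G \<subseteq> Pow (verts G)" "C \<subseteq> verts G"
  shows "vertex_cover G C \<longleftrightarrow> independent_set G (verts G - C)"
  using assms unfolding vertex_cover_def independent_set_def by blast

text \<open>Complementation in the vertex set exchanges vertex covers and independent sets. The
  complement of a largest independent set is a cover of the claimed size, and a smaller cover would
  leave an independent set larger than \<open>I\<close>.\<close>

lemma vertex_cover_number_eqI:
  assumes fin: "finite (verts G)" and edges: "edges G \<subseteq> Pow (verts G)"
    and I: "independent_set G I"
    and max: "\<And>J. independent_set G J \<Longrightarrow> card J \<le> card I"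
  shows "vertex_cover_number G = card (verts G) - card I"
  unfolding vertex_cover_number_def
proof (rule Least_equality)
  have sub: "I \<subseteq> verts G"
    using I by (simp add: independent_set_def)
  then have "verts G - (verts G - I) = I"
    by blast
  then have "vertex_cover G (verts G - I)"
    using I vertex_cover_iff_independent_set[OF edges, of "verts G - I"] by auto
  moreover have "card (verts G - I) = card (verts G) - card I"
    using sub fin by (simp add: card_Diff_subset finite_subset)
  ultimately show "\<exists>C. finite C \<and> vertex_cover G C \<and> card C = card (verts G) - card I"
    using fin by blast
next
  fix n
  assume "\<exists>C. finite C \<and> vertex_cover G C \<and> card C = n"
  then obtain C where C: "finite C" "vertex_cover G C" "card C = n"
    by blast
  then have sub: "C \<subseteq> verts G"
    by (simp add: vertex_cover_def)
  then have "card (verts G - C) \<le> card I"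
    using C max vertex_cover_iff_independent_set[OF edges] by blast
  then show "card (verts G) - card I \<le> n"
    using C sub by (simp add: card_Diff_subset)
qed

section \<open>Graphs given by an adjacency relation\<close>

lemma verts_graph_of_adj [simp]: "verts (graph_of_adj V adj) = V"
  by (simp add: graph_of_adj_def)

lemma edges_graph_of_adj:
  "edges (graph_of_adj V adj) = {{x, y} | x y. x \<in> V \<and> y \<in> V \<and> x \<noteq> y \<and> adj x y}"
  by (simp add: graph_of_adj_def)

text \<open>An edge is an unordered pair, so \<open>{x, y}\<close> could lie in the second edge set
  because of \<open>adj' y x\<close> alone. Symmetry of \<open>adj'\<close> rules this out and lets
  the difference be taken on the level of relations.\<close>

lemma edges_graph_of_adj_Diff:
  assumes sym: "\<And>x y. x \<in> V \<Longrightarrow> y \<in> V \<Longrightarrow> adj' x y \<Longrightarrow> adj' y x"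
  shows "edges (graph_of_adj V adj) - edges (graph_of_adj V adj') =
    edges (graph_of_adj V (\<lambda>x y. adj x y \<and> \<not> adj' x y))"
    (is "?A - ?B = ?C")
proof (intro equalityI subsetI)
  fix e assume "e \<in> ?A - ?B"
  then show "e \<in> ?C"
    unfolding edges_graph_of_adj by blast
next
  fix e assume "e \<in> ?C"
  then obtain x y where e: "e = {x, y}" "x \<in> V" "y \<in> V" "x \<noteq> y" "adj x y" "\<not> adj' x y"
    unfolding edges_graph_of_adj by blast
  have "e \<notin> ?B"
  proof
    assume "e \<in> ?B"
    then obtain a b where "e = {a, b}" "a \<in> V" "b \<in> V" "adj' a b"
      unfolding edges_graph_of_adj by blast
    with e sym show False
      by (metis doubleton_eq_iff)
  qed
  then show "e \<in> ?A - ?B"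
    using e unfolding edges_graph_of_adj by blast
qed

lemma edges_graph_of_adj_cong:
  assumes "\<And>x y. x \<in> V \<Longrightarrow> y \<in> V \<Longrightarrow> adj x y \<longleftrightarrow> adj' x y"
  shows "edges (graph_of_adj V adj) = edges (graph_of_adj V adj')"
  unfolding edges_graph_of_adj by (intro Collect_cong ex_cong1) (use assms in blast)

lemma independent_set_graph_of_adj:
  "independent_set (graph_of_adj V adj) I \<longleftrightarrow>
    I \<subseteq> V \<and> (\<forall>x \<in> I. \<forall>y \<in> I. x \<noteq> y \<longrightarrow> \<not> adj x y)"
proof (cases "I \<subseteq> V")
  case True
  have "(\<forall>e \<in> edges (graph_of_adj V adj). \<not> e \<subseteq> I) \<longleftrightarrow>
    (\<forall>x y. x \<in> V \<and> y \<in> V \<and> x \<noteq> y \<and> adj x y \<longrightarrow> \<not> {x, y} \<subseteq> I)"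
    unfolding edges_graph_of_adj mem_Collect_eq Ball_def by metis
  also have "\<dots> \<longleftrightarrow> (\<forall>x \<in> I. \<forall>y \<in> I. x \<noteq> y \<longrightarrow> \<not> adj x y)"
    using True by auto
  finally show ?thesis
    using True by (simp add: independent_set_def)
qed (simp add: independent_set_def)

section \<open>Products of lists of rings\<close>

text \<open>Lists of length \<open>n\<close> with prescribed entry sets correspond to extensional
  functions on \<open>{..<n}\<close>, whose number is known from \<open>card_PiE\<close>.\<close>

lemma card_lists_nth_mem:
  "card {xs. length xs = n \<and> (\<forall>i < n. xs ! i \<in> A i)} = (\<Prod>i < n. card (A i))"
proof -
  let ?L = "{xs. length xs = n \<and> (\<forall>i < n. xs ! i \<in> A i)}"
  have "bij_betw (\<lambda>f. map f [0..<n]) (\<Pi>\<^sub>E i \<in> {..<n}. A i) ?L"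
  proof (rule bij_betw_byWitness[where f' = "\<lambda>xs. \<lambda>i \<in> {..<n}. xs ! i"])
    show "\<forall>f \<in> \<Pi>\<^sub>E i \<in> {..<n}. A i. (\<lambda>i \<in> {..<n}. map f [0..<n] ! i) = f"
    proof
      fix f assume f: "f \<in> (\<Pi>\<^sub>E i \<in> {..<n}. A i)"
      have "(\<lambda>i \<in> {..<n}. map f [0..<n] ! i) = restrict f {..<n}"
        by (rule restrict_ext) simp
      then show "(\<lambda>i \<in> {..<n}. map f [0..<n] ! i) = f"
        using f by (simp add: PiE_restrict)
    qed
    show "\<forall>xs \<in> ?L. map (\<lambda>i \<in> {..<n}. xs ! i) [0..<n] = xs"
      by (simp add: list_eq_iff_nth_eq)
    show "(\<lambda>f. map f [0..<n]) ` (\<Pi>\<^sub>E i \<in> {..<n}. A i) \<subseteq> ?L"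
      by (simp add: image_subset_iff PiE_mem)
    show "(\<lambda>xs. \<lambda>i \<in> {..<n}. xs ! i) ` ?L \<subseteq> (\<Pi>\<^sub>E i \<in> {..<n}. A i)"
      by (simp add: image_subset_iff)
  qed
  then have "card ?L = card (\<Pi>\<^sub>E i \<in> {..<n}. A i)"
    by (rule bij_betw_same_card[symmetric])
  then show ?thesis
    by (simp add: card_PiE)
qed

text \<open>For distinct \<open>i\<close> and \<open>k\<close> both products share the factors over
  \<open>T - {i} - {k}\<close>. What is left is \<open>f k\<close> on one side and
  \<open>f i\<close> on the other.\<close>

lemma prod_remove_le:
  fixes f :: "'a \<Rightarrow> nat"
  assumes "finite T" "i \<in> T" "k \<in> T" "f k \<le> f i"
  shows "prod f (T - {i}) \<le> prod f (T - {k})"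
proof (cases "i = k")
  case False
  have "prod f (T - {i}) = f k * prod f (T - {i} - {k})"
    by (rule prod.remove) (use assms False in simp_all)
  also have "\<dots> \<le> f i * prod f (T - {i} - {k})"
    by (rule mult_right_mono[OF assms(4)]) simp
  also have "T - {i} - {k} = T - {k} - {i}"
    by blast
  also have "f i * prod f (T - {k} - {i}) = prod f (T - {k})"
    by (rule prod.remove[symmetric]) (use assms False in simp_all)
  finally show ?thesis .
qed simp

section \<open>Componentwise description of \<open>RDirProd_list\<close>\<close>

lemma RDirProd_list_carrier_iff:
  "xs \<in> carrier (RDirProd_list Rs) \<longleftrightarrow>
    length xs = length Rs \<and> (\<forall>i < length Rs. xs ! i \<in> carrier (Rs ! i))"
  using RDirProd_list_carrier_mem RDirProd_list_carrier_memI by metis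

lemma RDirProd_list_zero_nth:
  "length (\<zero>\<^bsub>RDirProd_list Rs\<^esub>) = length Rs"
  "i < length Rs \<Longrightarrow> \<zero>\<^bsub>RDirProd_list Rs\<^esub> ! i = \<zero>\<^bsub>Rs ! i\<^esub>"
proof -
  have "length (\<zero>\<^bsub>RDirProd_list Rs\<^esub>) = length Rs \<and>
    (\<forall>i < length Rs. \<zero>\<^bsub>RDirProd_list Rs\<^esub> ! i = \<zero>\<^bsub>Rs ! i\<^esub>)"
    by (induction Rs) (auto simp: RDirProd_list_zero nth_Cons monoid.defs split: nat.split)
  then show "length (\<zero>\<^bsub>RDirProd_list Rs\<^esub>) = length Rs"
    and "i < length Rs \<Longrightarrow> \<zero>\<^bsub>RDirProd_list Rs\<^esub> ! i = \<zero>\<^bsub>Rs ! i\<^esub>"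
    by auto
qed

text \<open>The map sending a pair \<open>(x, xs)\<close> to \<open>x # xs\<close> is a ring
  homomorphism, so the multiplication of lists is inherited from the binary product.\<close>

lemma RDirProd_list_mult_Cons:
  assumes "x \<in> carrier R" "xs \<in> carrier (RDirProd_list Rs)"
    and "y \<in> carrier R" "ys \<in> carrier (RDirProd_list Rs)"
  shows "(x # xs) \<otimes>\<^bsub>RDirProd_list (R # Rs)\<^esub> (y # ys) =
    (x \<otimes>\<^bsub>R\<^esub> y) # (xs \<otimes>\<^bsub>RDirProd_list Rs\<^esub> ys)"
proof -
  have "(x, xs) \<in> carrier (RDirProd R (RDirProd_list Rs))"
    and "(y, ys) \<in> carrier (RDirProd R (RDirProd_list Rs))"
    using assms by (auto simp: RDirProd_carrier)
  from ring_hom_mult[OF RDirProd_list_hom1 this] show ?thesis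
    by (simp add: RDirProd_def DirProd_def monoid.defs)
qed

lemma RDirProd_list_mult_nth:
  assumes "xs \<in> carrier (RDirProd_list Rs)" "ys \<in> carrier (RDirProd_list Rs)"
  shows "length (xs \<otimes>\<^bsub>RDirProd_list Rs\<^esub> ys) = length Rs"
    and "i < length Rs \<Longrightarrow> (xs \<otimes>\<^bsub>RDirProd_list Rs\<^esub> ys) ! i = xs ! i \<otimes>\<^bsub>Rs ! i\<^esub> ys ! i"
proof -
  from assms have "length (xs \<otimes>\<^bsub>RDirProd_list Rs\<^esub> ys) = length Rs \<and>
    (\<forall>i < length Rs. (xs \<otimes>\<^bsub>RDirProd_list Rs\<^esub> ys) ! i = xs ! i \<otimes>\<^bsub>Rs ! i\<^esub> ys ! i)"
  proof (induction Rs arbitrary: xs ys)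
    case Nil
    then show ?case
      by (simp add: monoid.defs)
  next
    case (Cons R Rs)
    from Cons.prems obtain x xs' y ys' where xs: "xs = x # xs'" "ys = y # ys'"
      and mem: "x \<in> carrier R" "xs' \<in> carrier (RDirProd_list Rs)"
        "y \<in> carrier R" "ys' \<in> carrier (RDirProd_list Rs)"
      by (auto simp: RDirProd_list_carrier)
    with Cons.IH[of xs' ys'] show ?case
      by (auto simp: RDirProd_list_mult_Cons nth_Cons split: nat.split)
  qed
  then show "length (xs \<otimes>\<^bsub>RDirProd_list Rs\<^esub> ys) = length Rs"
    and "i < length Rs \<Longrightarrow> (xs \<otimes>\<^bsub>RDirProd_list Rs\<^esub> ys) ! i = xs ! i \<otimes>\<^bsub>Rs ! i\<^esub> ys ! i"
    by auto
qed

section \<open>Supports in a product of fields\<close>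

locale field_product =
  fixes F :: "('a, 'm) ring_scheme list"
  assumes field_nth: "i < length F \<Longrightarrow> field (F ! i)"
begin

abbreviation R :: "'a list ring" where "R \<equiv> RDirProd_list F"

abbreviation T :: "nat set" where "T \<equiv> {..<length F}"

definition supp :: "'a list \<Rightarrow> nat set" where
  "supp x = {i \<in> T. x ! i \<noteq> \<zero>\<^bsub>F ! i\<^esub>}"

lemma supp_subset: "supp x \<subseteq> T"
  by (auto simp: supp_def)

lemma eq_zero_iff_supp:
  assumes "x \<in> carrier R"
  shows "x = \<zero>\<^bsub>R\<^esub> \<longleftrightarrow> supp x = {}"
  using assms RDirProd_list_zero_nth[where Rs = F]
  by (auto simp: supp_def RDirProd_list_carrier_iff list_eq_iff_nth_eq)

text \<open>A field has no nonzero zero-divisors, so a product vanishes exactly when at every index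
  one of the two components does.\<close>

lemma mult_eq_zero_iff_supp:
  assumes x: "x \<in> carrier R" and y: "y \<in> carrier R"
  shows "x \<otimes>\<^bsub>R\<^esub> y = \<zero>\<^bsub>R\<^esub> \<longleftrightarrow> supp x \<inter> supp y = {}"
proof -
  have "x ! i \<otimes>\<^bsub>F ! i\<^esub> y ! i = \<zero>\<^bsub>F ! i\<^esub> \<longleftrightarrow>
      x ! i = \<zero>\<^bsub>F ! i\<^esub> \<or> y ! i = \<zero>\<^bsub>F ! i\<^esub>" if i: "i < length F" for i
  proof -
    interpret field "F ! i"
      using field_nth i .
    show ?thesis
      using x y i by (simp add: RDirProd_list_carrier_iff integral_iff)
  qed
  then show ?thesis
    using RDirProd_list_zero_nth[where Rs = F] RDirProd_list_mult_nth[OF x y]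
    by (auto simp: supp_def list_eq_iff_nth_eq)
qed

text \<open>Every index set is a support, witnessed by its indicator vector. Existence questions
  about ring elements thereby become questions about subsets of \<open>T\<close>.\<close>

lemma supp_surj:
  assumes "S \<subseteq> T"
  obtains x where "x \<in> carrier R" "supp x = S"
proof
  let ?x = "map (\<lambda>i. if i \<in> S then \<one>\<^bsub>F ! i\<^esub> else \<zero>\<^bsub>F ! i\<^esub>) [0..<length F]"
  have *: "\<one>\<^bsub>F ! i\<^esub> \<in> carrier (F ! i)" "\<zero>\<^bsub>F ! i\<^esub> \<in> carrier (F ! i)"
    "\<one>\<^bsub>F ! i\<^esub> \<noteq> \<zero>\<^bsub>F ! i\<^esub>" if "i < length F" for i
  proof -
    interpret field "F ! i"
      using field_nth that .
    show "\<one>\<^bsub>F ! i\<^esub> \<in> carrier (F ! i)" "\<zero>\<^bsub>F ! i\<^esub> \<in> carrier (F ! i)"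
      "\<one>\<^bsub>F ! i\<^esub> \<noteq> \<zero>\<^bsub>F ! i\<^esub>"
      by simp_all
  qed
  then show "?x \<in> carrier R"
    by (simp add: RDirProd_list_carrier_iff)
  show "supp ?x = S"
    using assms * by (auto simp: supp_def split: if_splits)
qed

text \<open>A nonzero annihilator of \<open>x\<close> is a nonzero element supported outside
  \<open>supp x\<close>; one exists exactly when \<open>supp x\<close> leaves some index
  free.\<close>

lemma nonzero_zero_divisors_iff_supp:
  "x \<in> nonzero_zero_divisors R \<longleftrightarrow> x \<in> carrier R \<and> supp x \<noteq> {} \<and> supp x \<noteq> T"
proof (cases "x \<in> carrier R")
  case True
  have "(\<exists>y \<in> carrier R - {\<zero>\<^bsub>R\<^esub>}. x \<otimes>\<^bsub>R\<^esub> y = \<zero>\<^bsub>R\<^esub>) \<longleftrightarrow> supp x \<noteq> T" (is "?L \<longleftrightarrow> _")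
  proof
    assume ?L
    then obtain y where "y \<in> carrier R" "y \<noteq> \<zero>\<^bsub>R\<^esub>" "x \<otimes>\<^bsub>R\<^esub> y = \<zero>\<^bsub>R\<^esub>"
      by blast
    then have "supp y \<noteq> {}" "supp x \<inter> supp y = {}"
      using True by (simp_all add: mult_eq_zero_iff_supp eq_zero_iff_supp)
    then show "supp x \<noteq> T"
      using supp_subset[of y] by auto
  next
    assume "supp x \<noteq> T"
    then have ne: "T - supp x \<noteq> {}"
      using supp_subset[of x] by blast
    obtain y where y: "y \<in> carrier R" "supp y = T - supp x"
      by (rule supp_surj[of "T - supp x"]) auto
    with ne True show ?L
      by (intro bexI[of _ y]) (auto simp: mult_eq_zero_iff_supp eq_zero_iff_supp)
  qed
  then show ?thesis
    using True by (auto simp: nonzero_zero_divisors_def zero_divisors_def eq_zero_iff_supp)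
qed (auto simp: nonzero_zero_divisors_def zero_divisors_def)

text \<open>The required annihilators have disjoint nonempty supports, one outside
  \<open>supp x\<close> and the other outside \<open>supp y\<close>. They can be found as soon as
  the two complements contain distinct indices \<open>i\<close> and \<open>j\<close>, which fails
  only if both complements are the same singleton.\<close>

lemma weak_adjacent_iff_supp:
  assumes x: "x \<in> nonzero_zero_divisors R" and y: "y \<in> nonzero_zero_divisors R"
  shows "(\<exists>r \<in> Ann R x - {\<zero>\<^bsub>R\<^esub>}. \<exists>s \<in> Ann R y - {\<zero>\<^bsub>R\<^esub>}. r \<otimes>\<^bsub>R\<^esub> s = \<zero>\<^bsub>R\<^esub>) \<longleftrightarrow>
    \<not> (\<exists>i \<in> T. supp x = T - {i} \<and> supp y = T - {i})" (is "?L \<longleftrightarrow> \<not> ?M")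
proof
  have xy: "x \<in> carrier R" "y \<in> carrier R"
    using x y by (simp_all add: nonzero_zero_divisors_iff_supp)
  {
    assume ?L
    then obtain r s where "r \<in> carrier R" "r \<otimes>\<^bsub>R\<^esub> x = \<zero>\<^bsub>R\<^esub>" "r \<noteq> \<zero>\<^bsub>R\<^esub>"
      and "s \<in> carrier R" "s \<otimes>\<^bsub>R\<^esub> y = \<zero>\<^bsub>R\<^esub>" "s \<noteq> \<zero>\<^bsub>R\<^esub>" "r \<otimes>\<^bsub>R\<^esub> s = \<zero>\<^bsub>R\<^esub>"
      unfolding Ann_def by blast
    then have rs: "supp r \<noteq> {}" "supp r \<inter> supp x = {}" "supp s \<noteq> {}" "supp s \<inter> supp y = {}"
      "supp r \<inter> supp s = {}"
      using xy by (simp_all add: mult_eq_zero_iff_supp eq_zero_iff_supp)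
    \<comment> \<open>A nonempty set avoiding \<open>T - {i}\<close> must be \<open>{i}\<close>. If
      both supports are this coatom, \<open>r\<close> and \<open>s\<close> are both supported on
      \<open>{i}\<close>, and their product cannot vanish.\<close>
    have "A = {i}" if "supp z = T - {i}" "A \<noteq> {}" "A \<inter> supp z = {}" "A \<subseteq> T" for A z i
      using that by blast
    then have "supp r = supp s" if "supp x = T - {i}" "supp y = T - {i}" for i
      using that rs supp_subset by metis
    then show "\<not> ?M"
      using rs by (metis Int_absorb)
  next
    assume nM: "\<not> ?M"
    obtain i0 j0 where ij0: "i0 \<in> T - supp x" "j0 \<in> T - supp y"
      using x y supp_subset[of x] supp_subset[of y]
      unfolding nonzero_zero_divisors_iff_supp by blast
    have "\<exists>i j. i \<in> T - supp x \<and> j \<in> T - supp y \<and> i \<noteq> j"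
    proof (rule ccontr)
      assume "\<not> ?thesis"
      then have eq: "i = j" if "i \<in> T - supp x" "j \<in> T - supp y" for i j
        using that by blast
      \<comment> \<open>By \<open>eq\<close>, every index missing from one support equals every
        index missing from the other; hence \<open>i0 = j0\<close> and both complements shrink to
        one common singleton.\<close>
      have "T - supp x \<subseteq> {i0}" "T - supp y \<subseteq> {i0}"
        using eq[OF _ ij0(2)] eq[OF ij0(1)] eq[OF ij0] by blast+
      then have "T - supp x = {i0}" "T - supp y = {i0}"
        using ij0 by blast+
      then have "supp x = T - {i0}" "supp y = T - {i0}"
        by (metis double_diff supp_subset subset_refl)+
      then show False
        using nM ij0(1) by auto
    qed
    then obtain i j where ij: "i \<in> T - supp x" "j \<in> T - supp y" "i \<noteq> j"
      by blast
    obtain r where r: "r \<in> carrier R" "supp r = {i}"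
      by (rule supp_surj[of "{i}"]) (use ij in auto)
    obtain s where s: "s \<in> carrier R" "supp s = {j}"
      by (rule supp_surj[of "{j}"]) (use ij in auto)
    show ?L
      by (rule bexI[of _ r], rule bexI[of _ s])
        (use r s xy ij in \<open>auto simp: Ann_def mult_eq_zero_iff_supp eq_zero_iff_supp\<close>)
  }
qed

text \<open>The first conjunct expresses non-adjacency in the zero-divisor graph, the second
  adjacency in the weak one.\<close>

definition diff_adj :: "'a list \<Rightarrow> 'a list \<Rightarrow> bool" where
  "diff_adj x y \<longleftrightarrow>
    supp x \<inter> supp y \<noteq> {} \<and> \<not> (\<exists>i \<in> T. supp x = T - {i} \<and> supp y = T - {i})"

lemma edges_difference_graph:
  "edges (weak_zero_divisor_graph R) - edges (zero_divisor_graph R) =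
    edges (graph_of_adj (nonzero_zero_divisors R) diff_adj)"
proof -
  have "edges (weak_zero_divisor_graph R) - edges (zero_divisor_graph R) =
    edges (graph_of_adj (nonzero_zero_divisors R) (\<lambda>x y.
      (\<exists>r \<in> Ann R x - {\<zero>\<^bsub>R\<^esub>}. \<exists>s \<in> Ann R y - {\<zero>\<^bsub>R\<^esub>}. r \<otimes>\<^bsub>R\<^esub> s = \<zero>\<^bsub>R\<^esub>)
      \<and> \<not> x \<otimes>\<^bsub>R\<^esub> y = \<zero>\<^bsub>R\<^esub>))"
    unfolding weak_zero_divisor_graph_def zero_divisor_graph_def
    by (rule edges_graph_of_adj_Diff)
      (auto simp: nonzero_zero_divisors_iff_supp mult_eq_zero_iff_supp)
  also have "\<dots> = edges (graph_of_adj (nonzero_zero_divisors R) diff_adj)"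
  proof (rule edges_graph_of_adj_cong)
    fix x y assume xy: "x \<in> nonzero_zero_divisors R" "y \<in> nonzero_zero_divisors R"
    then have "x \<otimes>\<^bsub>R\<^esub> y = \<zero>\<^bsub>R\<^esub> \<longleftrightarrow> supp x \<inter> supp y = {}"
      by (simp add: nonzero_zero_divisors_iff_supp mult_eq_zero_iff_supp)
    then show "((\<exists>r \<in> Ann R x - {\<zero>\<^bsub>R\<^esub>}. \<exists>s \<in> Ann R y - {\<zero>\<^bsub>R\<^esub>}. r \<otimes>\<^bsub>R\<^esub> s = \<zero>\<^bsub>R\<^esub>)
      \<and> \<not> x \<otimes>\<^bsub>R\<^esub> y = \<zero>\<^bsub>R\<^esub>) \<longleftrightarrow> diff_adj x y"
      unfolding weak_adjacent_iff_supp[OF xy] diff_adj_def by blast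
  qed
  finally show ?thesis .
qed

text \<open>This shows that deleting isolated vertices removes nothing. It suffices to find a proper
  subset of \<open>T\<close> that meets \<open>supp x\<close> and differs from it: unequal supports
  cannot both be the same coatom.\<close>

lemma ex_diff_adj:
  assumes t: "length F \<ge> 3" and x: "x \<in> nonzero_zero_divisors R"
  obtains y where "y \<in> nonzero_zero_divisors R" "x \<noteq> y" "diff_adj x y"
proof -
  obtain i where i: "i \<in> supp x" "i \<in> T"
    using x supp_subset[of x] by (auto simp: nonzero_zero_divisors_iff_supp)
  obtain j where j: "j \<in> T" "j \<noteq> i"
    using t by (intro that[of "if i = 0 then 1 else 0"]) auto
  \<comment> \<open>The singleton \<open>{i}\<close> serves unless it is already
    \<open>supp x\<close>; then it is enlarged by \<open>j\<close>. In either case \<open>S\<close>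
    has at most two elements, so it is proper because there are at least three factors.\<close>
  define S where "S = (if supp x = {i} then {i, j} else {i})"
  have "card S < card T"
    using t by (auto simp: S_def card_insert_if)
  then have S: "S \<noteq> T" "S \<subseteq> T"
    using i(2) j(1) by (blast, simp add: S_def)
  have S': "i \<in> S" "S \<noteq> supp x"
    unfolding S_def using j(2) by (cases "supp x = {i}"; auto)+
  obtain y where y: "y \<in> carrier R" "supp y = S"
    using supp_surj S by blast
  show thesis
  proof
    show "y \<in> nonzero_zero_divisors R"
      using y S S' by (auto simp: nonzero_zero_divisors_iff_supp)
    show "x \<noteq> y"
      using y S' by blast
    show "diff_adj x y"
      unfolding diff_adj_def using y S' i by auto
  qed
qed

lemma weak_zero_divisor_difference_graph_eq:
  assumes "length F \<ge> 3"
  shows "weak_zero_divisor_difference_graph R = graph_of_adj (nonzero_zero_divisors R) diff_adj"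
proof -
  let ?V = "nonzero_zero_divisors R"
  have "\<exists>e \<in> edges (graph_of_adj ?V diff_adj). v \<in> e" if v: "v \<in> ?V" for v
  proof -
    obtain y where "y \<in> ?V" "v \<noteq> y" "diff_adj v y"
      using ex_diff_adj[OF assms v] .
    with v show ?thesis
      unfolding edges_graph_of_adj by blast
  qed
  then have "{v \<in> ?V. \<exists>e \<in> edges (graph_of_adj ?V diff_adj). v \<in> e} = ?V"
    by blast
  then show ?thesis
    unfolding weak_zero_divisor_difference_graph_def delete_isolated_def edges_difference_graph
    by (simp add: graph_of_adj_def)
qed

end

section \<open>Independent sets of the difference graph\<close>

locale finite_field_product = field_product F for F :: "('a, 'm) ring_scheme list" +
  assumes finite_nth: "i < length F \<Longrightarrow> finite (carrier (F ! i))"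
begin

text \<open>The number of ring elements with support \<open>T - {i}\<close>. The natural-number
  subtraction is never truncated, since a field has at least two elements.\<close>

abbreviation coatom_size :: "nat \<Rightarrow> nat" where
  "coatom_size i \<equiv> \<Prod>j \<in> T - {i}. order (F ! j) - 1"

section \<open>Finiteness and cardinalities\<close>

lemma order_gt_1:
  assumes "i < length F"
  shows "order (F ! i) > 1"
proof -
  interpret field "F ! i"
    using field_nth assms .
  have "card {\<zero>\<^bsub>F ! i\<^esub>, \<one>\<^bsub>F ! i\<^esub>} \<le> order (F ! i)"
    unfolding order_def by (rule card_mono) (use finite_nth assms in auto)
  then show ?thesis
    by simp
qed

lemma finite_carrier_RDirProd_list: "finite (carrier R)"
proof (rule finite_subset)
  show "carrier R \<subseteq> {xs. set xs \<subseteq> (\<Union>i<length F. carrier (F ! i)) \<and> length xs = length F}"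
    by (force simp: RDirProd_list_carrier_iff in_set_conv_nth)
  show "finite {xs. set xs \<subseteq> (\<Union>i<length F. carrier (F ! i)) \<and> length xs = length F}"
    by (rule finite_lists_length_eq) (use finite_nth in auto)
qed

lemma finite_nonzero_zero_divisors: "finite (nonzero_zero_divisors R)"
  by (rule finite_subset[OF _ finite_carrier_RDirProd_list])
    (auto simp: nonzero_zero_divisors_iff_supp)

text \<open>The support condition constrains each component separately: the one at \<open>i\<close>
  must be zero, and every other is an arbitrary nonzero field element.\<close>

lemma card_supp_eq_coatom:
  assumes i: "i \<in> T"
  shows "card {x \<in> carrier R. supp x = T - {i}} = coatom_size i"
proof -
  \<comment> \<open>The biconditional treats both cases uniformly: for \<open>j = i\<close> only
    zero is left, for all other \<open>j\<close> everything but zero.\<close>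
  let ?A = "\<lambda>j. {z \<in> carrier (F ! j). z \<noteq> \<zero>\<^bsub>F ! j\<^esub> \<longleftrightarrow> j \<noteq> i}"
  have zero: "\<zero>\<^bsub>F ! j\<^esub> \<in> carrier (F ! j)" if "j < length F" for j
  proof -
    interpret field "F ! j"
      using field_nth that .
    show ?thesis
      by simp
  qed
  have supp_iff: "supp x = T - {i} \<longleftrightarrow> (\<forall>j < length F. x ! j \<noteq> \<zero>\<^bsub>F ! j\<^esub> \<longleftrightarrow> j \<noteq> i)" for x
    unfolding supp_def set_eq_iff by auto
  have "{x \<in> carrier R. supp x = T - {i}} =
      {x. length x = length F \<and> (\<forall>j < length F. x ! j \<in> ?A j)}"
    by (rule Collect_cong) (simp only: RDirProd_list_carrier_iff supp_iff mem_Collect_eq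
      imp_conjR all_conj_distrib conj_assoc)
  then have "card {x \<in> carrier R. supp x = T - {i}} = (\<Prod>j \<in> T. card (?A j))"
    by (simp only: card_lists_nth_mem)
  also have "\<dots> = card (?A i) * (\<Prod>j \<in> T - {i}. card (?A j))"
    using i by (intro prod.remove) simp_all
  also have "?A i = {\<zero>\<^bsub>F ! i\<^esub>}"
    using zero i by auto
  also have "(\<Prod>j \<in> T - {i}. card (?A j)) = coatom_size i"
  proof (rule prod.cong)
    fix j assume j: "j \<in> T - {i}"
    then have "?A j = carrier (F ! j) - {\<zero>\<^bsub>F ! j\<^esub>}"
      by blast
    then show "card (?A j) = order (F ! j) - 1"
      using zero j by (simp add: order_def card_Diff_singleton)
  qed simp
  finally show ?thesis
    by simp
qed

text \<open>Omitting the smallest factor leaves the largest product; this is where the minimality of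
  the order at \<open>k\<close> enters.\<close>

lemma coatom_size_le:
  assumes "i \<in> T" "k \<in> T" "order (F ! k) \<le> order (F ! i)"
  shows "coatom_size i \<le> coatom_size k"
  using diff_le_mono[OF assms(3)]
  by (rule prod_remove_le[where f = "\<lambda>j. order (F ! j) - 1", OF finite_lessThan assms(1,2)])

text \<open>Choosing one index from each support is injective by disjointness, so there are at most
  as many elements as indices.\<close>

lemma card_le_disjoint_supp:
  assumes I: "I \<subseteq> nonzero_zero_divisors R"
    and disj: "\<And>x y. x \<in> I \<Longrightarrow> y \<in> I \<Longrightarrow> x \<noteq> y \<Longrightarrow> supp x \<inter> supp y = {}"
  shows "card I \<le> length F"
proof -
  have "\<exists>i. i \<in> supp x" if "x \<in> I" for x
    using I that nonzero_zero_divisors_iff_supp by blast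
  then obtain f where f: "\<And>x. x \<in> I \<Longrightarrow> f x \<in> supp x"
    by metis
  have "inj_on f I"
  proof (rule inj_onI, rule ccontr)
    fix x y assume "x \<in> I" "y \<in> I" "f x = f y" "x \<noteq> y"
    with disj[of x y] f[of x] f[of y] show False
      by auto
  qed
  moreover have "f ` I \<subseteq> T"
    using f supp_subset by blast
  ultimately have "card I \<le> card T"
    by (rule card_inj_on_le) simp
  then show ?thesis
    by simp
qed

text \<open>An element of \<open>I\<close> with another support than \<open>T - {i}\<close> must
  have support disjoint from it, hence equal to \<open>{i}\<close>. The elements of the first kind
  number at most \<open>coatom_size i\<close>, and there is at most one of the second kind.\<close>

lemma card_le_coatom:
  assumes t: "length F \<ge> 3"
    and I: "independent_set (graph_of_adj (nonzero_zero_divisors R) diff_adj) I"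
    and x: "x \<in> I" "supp x = T - {i}" and i: "i \<in> T"
  shows "card I \<le> 1 + coatom_size i"
proof -
  let ?A = "{y \<in> carrier R. supp y = T - {i}}" and ?B = "{y \<in> I. supp y = {i}}"
  have sub: "I \<subseteq> nonzero_zero_divisors R"
    and ind: "\<And>x y. x \<in> I \<Longrightarrow> y \<in> I \<Longrightarrow> x \<noteq> y \<Longrightarrow> \<not> diff_adj x y"
    using I by (auto simp: independent_set_graph_of_adj)
  have finB: "finite ?B"
    using finite_subset[OF sub finite_nonzero_zero_divisors] by simp
  have "I \<subseteq> ?A \<union> ?B"
  proof
    fix y assume y: "y \<in> I"
    then have yc: "y \<in> carrier R" "supp y \<noteq> {}" "supp y \<subseteq> T"
      using sub supp_subset by (auto simp: nonzero_zero_divisors_iff_supp)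
    show "y \<in> ?A \<union> ?B"
    proof (cases "supp y = T - {i}")
      case False
      \<comment> \<open>A common coatom would give \<open>supp y = supp x\<close>, which is excluded
        in this case, so non-adjacency to \<open>x\<close> can only come from disjoint
        supports.\<close>
      with x ind[OF x(1) y] i have "(T - {i}) \<inter> supp y = {}"
        unfolding diff_adj_def by (cases "x = y") auto
      with yc y show ?thesis
        by blast
    qed (use yc in auto)
  qed
  moreover have "card ?B \<le> 1"
  proof -
    have "y = z" if "y \<in> ?B" "z \<in> ?B" for y z
    proof (rule ccontr)
      assume "y \<noteq> z"
      with that have "\<not> diff_adj y z"
        using ind by blast
      moreover have yz: "supp y = {i}" "supp z = {i}"
        using that by simp_all
      \<comment> \<open>Both supports are \<open>{i}\<close> and thus meet, so non-adjacency forces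
        \<open>{i}\<close> to be a coatom. A coatom has \<open>length F - 1\<close> elements, which
        is at least two.\<close>
      ultimately obtain j where "j \<in> T" "supp y = T - {j}"
        unfolding diff_adj_def by blast
      with yz have j: "j \<in> T" "{i} = T - {j}"
        by simp_all
      then have "card (T - {j}) = 1"
        by (metis card_1_singleton_iff One_nat_def)
      with j t show False
        by simp
    qed
    with finB show ?thesis
      by (simp add: card_le_Suc0_iff_eq)
  qed
  moreover have "finite ?A"
    using finite_carrier_RDirProd_list by simp
  ultimately show ?thesis
    using card_mono[of "?A \<union> ?B" I] card_Un_le[of ?A ?B] card_supp_eq_coatom[OF i] finB
    by simp
qed

text \<open>If some support is a coatom, the bound for that coatom applies and is largest at
  \<open>k\<close>. Otherwise non-adjacency means disjoint supports, and the number of indices is a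
  bound.\<close>

lemma card_independent_set_le:
  assumes t: "length F \<ge> 3" and k: "k \<in> T"
    and min: "\<And>i. i \<in> T \<Longrightarrow> order (F ! k) \<le> order (F ! i)"
    and I: "independent_set (graph_of_adj (nonzero_zero_divisors R) diff_adj) I"
  shows "card I \<le> max (length F) (1 + coatom_size k)"
proof (cases "\<exists>x \<in> I. \<exists>i \<in> T. supp x = T - {i}")
  case True
  then obtain x i where "x \<in> I" "i \<in> T" "supp x = T - {i}"
    by blast
  then have "card I \<le> 1 + coatom_size i" "coatom_size i \<le> coatom_size k"
    using card_le_coatom[OF t I] coatom_size_le[OF _ k min] by blast+
  then show ?thesis
    by simp
next
  case False
  then have "card I \<le> length F"
    using I by (intro card_le_disjoint_supp) (auto simp: independent_set_graph_of_adj diff_adj_def)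
  then show ?thesis
    by simp
qed

text \<open>One element for each singleton support: the supports are pairwise disjoint, and they are
  proper because there is more than one index.\<close>

lemma ex_independent_set_length:
  assumes t: "length F \<ge> 3"
  obtains I where "independent_set (graph_of_adj (nonzero_zero_divisors R) diff_adj) I"
    "card I = length F"
proof -
  have "\<exists>x. x \<in> carrier R \<and> supp x = {i}" if "i \<in> T" for i
    using supp_surj[of "{i}"] that by auto
  then obtain e where e: "\<And>i. i \<in> T \<Longrightarrow> e i \<in> carrier R" "\<And>i. i \<in> T \<Longrightarrow> supp (e i) = {i}"
    by metis
  have "{i} \<noteq> T" for i
  proof
    assume "{i} = T"
    then have "card T = card {i}"
      by simp
    with t show False
      by simp
  qed
  then have "e i \<in> nonzero_zero_divisors R" if "i \<in> T" for i
    using e[OF that] by (simp add: nonzero_zero_divisors_iff_supp)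
  moreover have "\<not> diff_adj (e i) (e j)" if "i \<in> T" "j \<in> T" "e i \<noteq> e j" for i j
    using e(2) that by (auto simp: diff_adj_def)
  ultimately have "independent_set (graph_of_adj (nonzero_zero_divisors R) diff_adj) (e ` T)"
    unfolding independent_set_graph_of_adj by blast
  moreover have "inj_on e T"
    using e(2) by (metis inj_onI singleton_inject)
  then have "card (e ` T) = length F"
    by (simp add: card_image)
  ultimately show thesis
    using that by blast
qed

text \<open>All elements with support \<open>T - {k}\<close> are mutually non-adjacent, since they
  share a coatom; one element with support \<open>{k}\<close> can be added because its support is
  disjoint from theirs.\<close>

lemma ex_independent_set_coatom:
  assumes t: "length F \<ge> 3" and k: "k \<in> T"
  obtains I where "independent_set (graph_of_adj (nonzero_zero_divisors R) diff_adj) I"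
    "card I = 1 + coatom_size k"
proof -
  let ?A = "{y \<in> carrier R. supp y = T - {k}}"
  obtain e where e: "e \<in> carrier R" "supp e = {k}"
    by (rule supp_surj[of "{k}"]) (use k in auto)
  have "card (T - {k}) \<noteq> 0" "card T \<noteq> card {k}"
    using t k by simp_all
  then have T: "T - {k} \<noteq> {}" "{k} \<noteq> T"
    by (metis card.empty, metis)
  have coatom: "T - {k} \<noteq> T"
    using k by blast
  have "e \<in> nonzero_zero_divisors R" "?A \<subseteq> nonzero_zero_divisors R"
    using e T coatom by (simp_all add: nonzero_zero_divisors_iff_supp subset_iff)
  moreover have "\<not> diff_adj x y" if "x \<in> insert e ?A" "y \<in> insert e ?A" "x \<noteq> y" for x y
  proof -
    have "(supp x = T - {k} \<and> supp y = T - {k}) \<or> supp x \<inter> supp y = {}"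
      using that e by auto
    then show ?thesis
      using k unfolding diff_adj_def by blast
  qed
  ultimately have "independent_set (graph_of_adj (nonzero_zero_divisors R) diff_adj) (insert e ?A)"
    unfolding independent_set_graph_of_adj by blast
  moreover have "e \<notin> ?A" "finite ?A"
    using e finite_carrier_RDirProd_list by (blast, simp)
  then have "card (insert e ?A) = 1 + coatom_size k"
    using card_supp_eq_coatom[OF k] by simp
  ultimately show thesis
    using that by blast
qed

lemma vertex_cover_number_difference_graph:
  assumes t: "length F \<ge> 3" and k: "k \<in> T"
    and min: "\<And>i. i \<in> T \<Longrightarrow> order (F ! k) \<le> order (F ! i)"
  shows "int (vertex_cover_number (weak_zero_divisor_difference_graph R)) =
    int (card (nonzero_zero_divisors R)) - int (max (length F) (1 + coatom_size k))"
proof -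
  let ?G = "graph_of_adj (nonzero_zero_divisors R) diff_adj"
  \<comment> \<open>Of the two constructions, the one with the larger cardinality attains the
    maximum.\<close>
  obtain I where I: "independent_set ?G I" "card I = max (length F) (1 + coatom_size k)"
    using ex_independent_set_length[OF t] ex_independent_set_coatom[OF t k] by (metis max_def)
  have "vertex_cover_number ?G = card (verts ?G) - card I"
  proof (rule vertex_cover_number_eqI)
    show "edges ?G \<subseteq> Pow (verts ?G)"
      by (auto simp: edges_graph_of_adj)
    show "card J \<le> card I" if "independent_set ?G J" for J
      using card_independent_set_le[OF t k min that] I by simp
  qed (use I finite_nonzero_zero_divisors in auto)
  \<comment> \<open>With this inequality the natural-number difference is exact and commutes with
    the embedding into the integers.\<close>
  moreover have "card I \<le> card (nonzero_zero_divisors R)"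
    using I finite_nonzero_zero_divisors by (intro card_mono) (auto simp: independent_set_def)
  ultimately show ?thesis
    using I(2) weak_zero_divisor_difference_graph_eq[OF t] by (simp add: of_nat_diff)
qed

end

theorem corollary7p7:
  fixes F :: "('a, 'm) ring_scheme list"
    and R :: "'a list ring"
    and t k :: nat
    and q :: "nat \<Rightarrow> nat"
  assumes "length F = t"
    and "t \<ge> 3"
    and "\<And>i. i < t \<Longrightarrow> field (F ! i)"
    and "\<And>i. i < t \<Longrightarrow> finite (carrier (F ! i))"
    and "\<And>i. i < t \<Longrightarrow> q i = order (F ! i)"
    and "R = RDirProd_list F"
    and "k < t"
    and "\<And>i. i < t \<Longrightarrow> q k \<le> q i"
  shows "int (vertex_cover_number (weak_zero_divisor_difference_graph R)) =
    int (card (nonzero_zero_divisors R)) -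
      max (int t) (1 + (\<Prod>i \<in> {..<t} - {k}. int (q i) - 1))"
proof -
  interpret finite_field_product F
    by (intro finite_field_product.intro field_product.intro finite_field_product_axioms.intro)
      (use assms(1,3,4) in auto)
  \<comment> \<open>Every order exceeds 1, so truncated subtraction agrees with the integer
    subtraction used in the conclusion.\<close>
  have "int (order (F ! i) - 1) = int (q i) - 1" if "i < t" for i
    using order_gt_1[of i] assms(1,5) that by simp
  then have prod: "int (coatom_size k) = (\<Prod>i \<in> {..<t} - {k}. int (q i) - 1)"
    unfolding of_nat_prod using assms(1) by (intro prod.cong) auto
  have "order (F ! k) \<le> order (F ! i)" if "i \<in> {..<length F}" for i
    using that assms(1,5,7,8) by auto
  then have "int (vertex_cover_number (weak_zero_divisor_difference_graph (RDirProd_list F))) =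
      int (card (nonzero_zero_divisors (RDirProd_list F))) - int (max (length F) (1 + coatom_size k))"
    using assms(1,2,7) by (intro vertex_cover_number_difference_graph) simp_all
  then show ?thesis
    unfolding of_nat_max of_nat_add of_nat_1 prod unfolding assms(1,6) .
qed

end
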